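(* Let $\mathcal{X}$ be an infinite-dimensional real Banach space, let $\mathcal{A}\subset\mathcal{B}(\mathcal{X})$ be an $L$-algebra, and let $r(\mathcal{A})=\min\{\mathrm{rank}(T): 0\neq T\in\mathcal{A}^F\}$. Then $\mathcal{A}$ is of real type if and only if $r(\mathcal{A})=1$; $\mathcal{A}$ is of complex type if and only if $r(\mathcal{A})=2$; and $\mathcal{A}$ is of quaternion type if and only if $r(\mathcal{A})=4$.
   Context: $\mathcal{B}(\mathcal{X})$ denotes the algebra of all bounded linear operators on $\mathcal{X}$. An algebra of operators on $\mathcal{X}$ is a (real) subalgebra of $\mathcal{B}(\mathcal{X})$, not assumed unital or closed. It is transitive if it has no non-trivial closed invariant subspaces, equivalently if for any $\varepsilon>0$ and any $x,y\in\mathcal{X}$ with $x\neq 0$ there is $T\in\mathcal{A}$ with $\|Tx-y\|<\varepsilon$. An $L$-algebra is a transitive algebra of operators on $\mathcal{X}$ that contains a non-zero finite rank operator. For an $L$-algebra $\mathcal{A}$, $\mathcal{A}^F$ is the set of all finite rank operators in $\mathcal{A}$, and $\mathcal{X}^F=\mathrm{lin}\{Tx: T\in\mathcal{A}^F, x\in\mathcal{X}\}$ (a dense $\mathcal{A}$-invariant linear subspace). $\mathbb{D}$ is the algebra of all linear operators $\mathcal{X}^F\to\mathcal{X}^F$ (not assumed bounded) commuting with the restrictions to $\mathcal{X}^F$ of all operators in $\mathcal{A}^F$; it is always a finite-dimensional real division algebra, hence isomorphic to $\mathbb{R}$, $\mathbb{C}$ or the quaternions $\mathbb{H}$. $\mathcal{A}$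 is of real, complex or quaternion type if $\mathbb{D}$ is isomorphic to $\mathbb{R}$, $\mathbb{C}$ or $\mathbb{H}$, respectively. The rank of an operator is the (real) dimension of its range. *)

theory Defs
  imports "HOL-Analysis.Analysis"
begin

section \<open>The quaternions as a real algebra\<close>

text \<open>\<open>Quat a b c d\<close> is the quaternion $a + bi + cj + dk$.\<close>

datatype quat = Quat (qre: real) (qi: real) (qj: real) (qk: real)

instantiation quat :: real_algebra_1
begin

definition "0 = Quat 0 0 0 0"

definition "1 = Quat 1 0 0 0"

definition "p + q = Quat (qre p + qre q) (qi p + qi q) (qj p + qj q) (qk p + qk q)"

definition "- q = Quat (- qre q) (- qi q) (- qj q) (- qk q)"

definition "p - q = Quat (qre p - qre q) (qi p - qi q) (qj p - qj q) (qk p - qk q)"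

definition "r *\<^sub>R q = Quat (r * qre q) (r * qi q) (r * qj q) (r * qk q)"

definition
  "p * q = Quat
     (qre p * qre q - qi p * qi q - qj p * qj q - qk p * qk q)
     (qre p * qi q + qi p * qre q + qj p * qk q - qk p * qj q)
     (qre p * qj q - qi p * qk q + qj p * qre q + qk p * qi q)
     (qre p * qk q + qi p * qj q - qj p * qi q + qk p * qre q)"

instance
  by standard
    (simp_all add: zero_quat_def one_quat_def plus_quat_def uminus_quat_def minus_quat_def
      scaleR_quat_def times_quat_def algebra_simps)

end

instantiation quat :: real_div_algebra
begin

definition
  "inverse q = inverse ((qre q)\<^sup>2 + (qi q)\<^sup>2 + (qj q)\<^sup>2 + (qk q)\<^sup>2) *\<^sub>R
     Quat (qre q) (- qi q) (- qj q) (- qk q)"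

definition "p div q = p * inverse (q :: quat)"

instance
proof
  fix q :: quat
  define n where "n = (qre q)\<^sup>2 + (qi q)\<^sup>2 + (qj q)\<^sup>2 + (qk q)\<^sup>2"
  define c where "c = Quat (qre q) (- qi q) (- qj q) (- qk q)"
  have inv: "inverse q = inverse n *\<^sub>R c"
    by (simp add: inverse_quat_def n_def c_def)
  have comm: "c * q = n *\<^sub>R 1" "q * c = n *\<^sub>R 1"
    by (simp_all add: c_def n_def times_quat_def scaleR_quat_def one_quat_def power2_eq_square)
  {
    assume "q \<noteq> 0"
    then have "n \<noteq> 0"
      by (cases q) (auto simp: n_def zero_quat_def add_nonneg_eq_0_iff)
    then show "inverse q * q = 1" "q * inverse q = 1"
      by (simp_all add: inv comm)
  }
  show "inverse (0 :: quat) = 0"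
    by (simp add: inverse_quat_def zero_quat_def scaleR_quat_def)
qed (simp add: divide_quat_def)

end


section \<open>L-algebras of operators\<close>

definition finite_dim :: "'a::real_vector set \<Rightarrow> bool" where
  "finite_dim S \<longleftrightarrow> (\<exists>B. finite B \<and> S \<subseteq> span B)"

definition finite_rank :: "('a::real_normed_vector \<Rightarrow>\<^sub>L 'a) \<Rightarrow> bool" where
  "finite_rank T \<longleftrightarrow> finite_dim (range (blinfun_apply T))"

text \<open>
  \<^const>\<open>dim\<close> takes a junk value on infinite-dimensional sets, so \<open>op_rank\<close> is meaningful
  only for operators of finite rank.
\<close>

definition op_rank :: "('a::real_normed_vector \<Rightarrow>\<^sub>L 'a) \<Rightarrow> nat" where
  "op_rank T = dim (range (blinfun_apply T))"

definition operator_algebra :: "('a::real_normed_vector \<Rightarrow>\<^sub>L 'a) set \<Rightarrow> bool" where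
  "operator_algebra A \<longleftrightarrow> subspace A \<and> (\<forall>S\<in>A. \<forall>T\<in>A. S o\<^sub>L T \<in> A)"

definition transitive_algebra :: "('a::real_normed_vector \<Rightarrow>\<^sub>L 'a) set \<Rightarrow> bool" where
  "transitive_algebra A \<longleftrightarrow>
     (\<forall>M. closed M \<and> subspace M \<and> (\<forall>T\<in>A. blinfun_apply T ` M \<subseteq> M) \<longrightarrow> M = {0} \<or> M = UNIV)"

definition L_algebra :: "('a::real_normed_vector \<Rightarrow>\<^sub>L 'a) set \<Rightarrow> bool" where
  "L_algebra A \<longleftrightarrow>
     operator_algebra A \<and> transitive_algebra A \<and> (\<exists>T\<in>A. T \<noteq> 0 \<and> finite_rank T)"

definition fin_part :: "('a::real_normed_vector \<Rightarrow>\<^sub>L 'a) set \<Rightarrow> ('a \<Rightarrow>\<^sub>L 'a) set" where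
  "fin_part A = {T \<in> A. finite_rank T}"

definition fin_space :: "('a::real_normed_vector \<Rightarrow>\<^sub>L 'a) set \<Rightarrow> 'a set" where
  "fin_space A = span {blinfun_apply T x | T x. T \<in> fin_part A}"

definition min_rank :: "('a::real_normed_vector \<Rightarrow>\<^sub>L 'a) set \<Rightarrow> nat" where
  "min_rank A = (LEAST n. \<exists>T\<in>fin_part A. T \<noteq> 0 \<and> op_rank T = n)"


section \<open>The commutant and the type of an L-algebra\<close>

text \<open>
  A linear operator on the subspace \<open>fin_space A\<close> is represented by the total function that
  agrees with it on \<open>fin_space A\<close> and vanishes elsewhere. In this representation the sum, the
  scalar multiples and the product of operators are the pointwise operations and composition of
  total functions, while the identity operator is the identity function cut off outside
  \<open>fin_space A\<close>.
\<close>

definition commutant :: "('a::real_normed_vector \<Rightarrow>\<^sub>L 'a) set \<Rightarrow> ('a \<Rightarrow> 'a) set" where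
  "commutant A = {S.
     (\<forall>x. x \<notin> fin_space A \<longrightarrow> S x = 0) \<and>
     (\<forall>x\<in>fin_space A. S x \<in> fin_space A) \<and>
     (\<forall>x\<in>fin_space A. \<forall>y\<in>fin_space A. S (x + y) = S x + S y) \<and>
     (\<forall>c. \<forall>x\<in>fin_space A. S (c *\<^sub>R x) = c *\<^sub>R S x) \<and>
     (\<forall>T\<in>fin_part A. \<forall>x\<in>fin_space A. S (blinfun_apply T x) = blinfun_apply T (S x))}"

definition commutant_iso ::
  "('a::real_normed_vector \<Rightarrow>\<^sub>L 'a) set \<Rightarrow> ('b::real_algebra_1 \<Rightarrow> 'a \<Rightarrow> 'a) \<Rightarrow> bool" where
  "commutant_iso A \<phi> \<longleftrightarrow>
     bij_betw \<phi> UNIV (commutant A) \<and>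
     (\<forall>a b. \<phi> (a + b) = (\<lambda>x. \<phi> a x + \<phi> b x)) \<and>
     (\<forall>c a. \<phi> (c *\<^sub>R a) = (\<lambda>x. c *\<^sub>R \<phi> a x)) \<and>
     (\<forall>a b. \<phi> (a * b) = \<phi> a \<circ> \<phi> b) \<and>
     \<phi> 1 = (\<lambda>x. if x \<in> fin_space A then x else 0)"

definition real_type :: "('a::real_normed_vector \<Rightarrow>\<^sub>L 'a) set \<Rightarrow> bool" where
  "real_type A \<longleftrightarrow> (\<exists>\<phi> :: real \<Rightarrow> 'a \<Rightarrow> 'a. commutant_iso A \<phi>)"

definition complex_type :: "('a::real_normed_vector \<Rightarrow>\<^sub>L 'a) set \<Rightarrow> bool" where
  "complex_type A \<longleftrightarrow> (\<exists>\<phi> :: complex \<Rightarrow> 'a \<Rightarrow> 'a. commutant_iso A \<phi>)"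

definition quaternion_type :: "('a::real_normed_vector \<Rightarrow>\<^sub>L 'a) set \<Rightarrow> bool" where
  "quaternion_type A \<longleftrightarrow> (\<exists>\<phi> :: quat \<Rightarrow> 'a \<Rightarrow> 'a. commutant_iso A \<phi>)"

end

theory Submission
  imports Defs "HOL-Computational_Algebra.Fundamental_Theorem_Algebra"
begin

text \<open>
The minimal rank is the dimension of the commutant, and the commutant is a division algebra; so
the theorem is Frobenius' classification read off from dimensions.

Let \<open>F\<close> be the algebra of finite rank operators in \<open>A\<close>. By transitivity every nonzero vector has
a dense orbit under \<open>A\<close>. A finite rank operator maps such an orbit onto its whole range
(\<open>orbit_fin_part_range\<close>), because finite-dimensional subspaces are closed. As \<open>F\<close> is an ideal, it
follows that \<open>F x\<close> equals \<open>fin_space A\<close> for each \<open>x \<noteq> 0\<close> (\<open>fin_part_irreducible\<close>). In particular an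
element of the commutant is determined by its value at one nonzero vector.

Now choose \<open>T\<close> in \<open>F\<close> of minimal nonzero rank and a nonzero vector \<open>e\<close> in its range \<open>V\<close>. Elements
of the commutant commute with \<open>T\<close> and so preserve \<open>V\<close>. Conversely, for each \<open>w\<close> in \<open>V\<close> the rule
\<open>G e \<mapsto> G w\<close>, for \<open>G\<close> in \<open>F\<close>, defines an element of the commutant that sends \<open>e\<close> to \<open>w\<close>
(\<open>commutant_exists\<close>). It is well defined by minimality: an operator in \<open>F\<close> with values in \<open>V\<close>
either vanishes on \<open>V\<close> or is injective there (\<open>minimal_rank_injective\<close>). Thus evaluation at \<open>e\<close>
is a linear bijection from the commutant onto \<open>V\<close>, and the dimension of the commutant is the
minimal rank.

Transporting composition along this bijection makes \<open>V\<close> a finite-dimensional division algebra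
with unit \<open>e\<close>, so one of the three types occurs (\<open>frobenius\<close>). The dimensions 1, 2 and 4 of the
three model algebras are distinct, hence the minimal rank tells the types apart.
\<close>

section \<open>Finite-dimensional subspaces\<close>

lemma finite_dim_mono: "finite_dim T \<Longrightarrow> S \<subseteq> T \<Longrightarrow> finite_dim S"
  unfolding finite_dim_def by blast

lemma finite_dim_linear_image:
  assumes "linear f" "finite_dim S"
  shows "finite_dim (f ` S)"
proof -
  obtain B where "finite B" "S \<subseteq> span B"
    using assms(2) unfolding finite_dim_def by blast
  then show ?thesis
    using linear_span_image[OF assms(1), of B] unfolding finite_dim_def
    by (intro exI[of _ "f ` B"]) auto
qed

lemma independent_in_finite_dim:
  assumes "independent B" "B \<subseteq> V" "finite_dim V"
  shows "finite B"
proof -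
  obtain W where W: "finite W" "V \<subseteq> span W"
    using assms(3) unfolding finite_dim_def by blast
  have "B \<subseteq> span W"
    using assms(2) W(2) by (rule order_trans)
  from independent_span_bound[OF W(1) assms(1) this] show ?thesis ..
qed

lemma finite_dim_basis:
  assumes "subspace V" "finite_dim V"
  obtains B where "finite B" "independent B" "span B = V" "card B = dim V"
proof -
  obtain B where B: "B \<subseteq> V" "independent B" "V \<subseteq> span B" "card B = dim V"
    by (rule basis_exists)
  have "finite B"
    using B assms(2) by (intro independent_in_finite_dim)
  moreover have "span B = V"
    using B assms(1) by (simp add: span_minimal subset_antisym)
  ultimately show ?thesis using that B by blast
qed

text \<open>
If \<open>b\<close> is a new vector, it has positive distance \<open>d\<close> from the closed subspace \<open>span B\<close>, and the
coefficient of \<open>b\<close> depends on the vector in a Lipschitz way, with constant \<open>1 / d\<close>. Along a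
convergent sequence the coefficients are therefore Cauchy, and both components converge.
\<close>

lemma closed_span_insert:
  fixes b :: "'a::real_normed_vector"
  assumes cl: "closed (span B)"
  shows "closed (span (insert b B))"
proof (cases "b \<in> span B")
  case True
  then show ?thesis using cl by (simp add: span_redundant)
next
  case False
  define d where "d = infdist b (span B)"
  have dpos: "d > 0"
    unfolding d_def using cl False span_zero by (intro infdist_pos_not_in_closed) auto
  have lower: "\<bar>t\<bar> * d \<le> norm (t *\<^sub>R b + w)" if "w \<in> span B" for t w
  proof (cases "t = 0")
    case False
    have "- inverse t *\<^sub>R w \<in> span B"
      using that by (intro span_scale)
    then have "d \<le> dist b (- inverse t *\<^sub>R w)"
      unfolding d_def by (rule infdist_le)
    also have "\<dots> = norm (inverse t *\<^sub>R (t *\<^sub>R b + w))"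
      using False by (simp add: dist_norm scaleR_add_right)
    also have "\<dots> = norm (t *\<^sub>R b + w) / \<bar>t\<bar>"
      by (simp add: divide_inverse_commute)
    finally show ?thesis
      using False by (simp add: field_simps)
  qed simp
  show ?thesis
    unfolding closed_sequential_limits
  proof (intro allI impI, elim conjE)
    fix s l
    assume "\<forall>n. s n \<in> span (insert b B)" and sl: "s \<longlonglongrightarrow> l"
    then have "\<forall>n. \<exists>t. s n - t *\<^sub>R b \<in> span B"
      by (simp add: span_insert)
    then obtain t where t: "\<And>n. s n - t n *\<^sub>R b \<in> span B"
      by metis
    have step: "\<bar>t m - t n\<bar> \<le> norm (s m - s n) / d" for m n
    proof -
      have "(s m - t m *\<^sub>R b) - (s n - t n *\<^sub>R b) \<in> span B"
        by (rule span_diff[OF t t])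
      from lower[OF this, of "t m - t n"] show ?thesis
        using dpos by (simp add: algebra_simps pos_le_divide_eq)
    qed
    have "Cauchy t"
    proof (rule CauchyI)
      fix e :: real
      assume "e > 0"
      then obtain M where M: "\<forall>m\<ge>M. \<forall>n\<ge>M. norm (s m - s n) < e * d"
        using CauchyD[OF LIMSEQ_imp_Cauchy[OF sl], of "e * d"] dpos by (auto simp only: mult_pos_pos)
      have "norm (t m - t n) < e" if "m \<ge> M" "n \<ge> M" for m n
      proof -
        have "norm (s m - s n) / d < e"
          using M that dpos by (simp add: pos_divide_less_eq)
        then show ?thesis
          using step[of m n] by simp
      qed
      then have "\<forall>m\<ge>M. \<forall>n\<ge>M. norm (t m - t n) < e"
        by simp
      then show "\<exists>M. \<forall>m\<ge>M. \<forall>n\<ge>M. norm (t m - t n) < e" ..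
    qed
    then obtain t0 where "t \<longlonglongrightarrow> t0"
      by (auto simp: Cauchy_convergent_iff convergent_def)
    then have "(\<lambda>n. s n - t n *\<^sub>R b) \<longlonglongrightarrow> l - t0 *\<^sub>R b"
      using sl by (intro tendsto_intros)
    with cl t have "l - t0 *\<^sub>R b \<in> span B"
      by (rule closed_sequentially)
    then show "l \<in> span (insert b B)"
      by (auto simp: span_insert)
  qed
qed

lemma finite_dim_subspace_closed:
  fixes V :: "'a::real_normed_vector set"
  assumes "subspace V" "finite_dim V"
  shows "closed V"
proof -
  obtain B where B: "finite B" "span B = V"
    using finite_dim_basis[OF assms] by metis
  have "closed (span B)"
    using B(1) by (induction B) (auto intro: closed_span_insert)
  then show ?thesis using B by simp
qed

lemma subspace_eq_of_dim_le:
  assumes "subspace U" "subspace V" "finite_dim V" "U \<subseteq> V" "dim V \<le> dim U"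
  shows "U = V"
proof -
  obtain B where B: "finite B" "independent B" "span B = U" "card B = dim U"
    using finite_dim_basis[OF assms(1) finite_dim_mono[OF assms(3,4)]] .
  have "B \<subseteq> V"
    using B(3) assms(4) span_superset[of B] by simp
  then obtain C where C: "B \<subseteq> C" "C \<subseteq> V" "independent C" "V \<subseteq> span C"
    by (rule maximal_independent_subset_extend[OF _ B(2)])
  have "finite C"
    using C(2,3) assms(3) by (intro independent_in_finite_dim)
  moreover have "card C = dim V"
    using C by (simp add: basis_card_eq_dim)
  ultimately have "B = C"
    using B C assms(5) by (simp add: card_seteq)
  then show ?thesis
    using B C assms(4) by blast
qed

text \<open>
A nonzero kernel vector can be completed to a basis of \<open>V\<close>; the images of the remaining basis
vectors would span \<open>V\<close>, and there are too few of them.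
\<close>

lemma linear_surj_on_finite_dim_inj:
  assumes "linear f" "subspace V" "finite_dim V" "f ` V = V" "v \<in> V" "f v = 0"
  shows "v = 0"
proof (rule ccontr)
  assume "v \<noteq> 0"
  then have "independent {v}" by simp
  then obtain C where C: "{v} \<subseteq> C" "C \<subseteq> V" "independent C" "V \<subseteq> span C"
    using maximal_independent_subset_extend[of "{v}" V] assms(5) by auto
  have fin: "finite C"
    using C assms(3) by (intro independent_in_finite_dim)
  have card: "card C = dim V"
    using C by (simp add: basis_card_eq_dim)
  have "V \<subseteq> span (f ` C)"
    using image_mono[OF C(4), of f] assms(4) linear_span_image[OF assms(1), of C] by simp
  also have "f ` C = insert 0 (f ` (C - {v}))"
    using C(1) assms(6) by auto
  finally have "V \<subseteq> span (f ` (C - {v}))" by simp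
  then have "dim V \<le> card (f ` (C - {v}))"
    using fin by (intro dim_le_card) auto
  also have "\<dots> \<le> card (C - {v})"
    using fin by (intro card_image_le) auto
  also have "\<dots> < card C"
    using fin C(1) by (intro psubset_card_mono) auto
  finally show False using card by simp
qed

lemma dim_linear_bij:
  fixes g :: "'b::real_vector \<Rightarrow> 'a::real_vector"
  assumes "linear g" "inj g" "range g = V"
  shows "dim V = dim (UNIV :: 'b set)"
proof -
  obtain B :: "'b set" where B: "independent B" "UNIV \<subseteq> span B" "card B = dim (UNIV :: 'b set)"
    by (rule basis_exists)
  have "independent (g ` B)"
    using assms(1) B(1) inj_on_subset[OF assms(2)] by (intro linear_independent_injective_image) auto
  moreover have "span (g ` B) = V"
    using linear_span_image[OF assms(1), of B] B(2) assms(3) by (simp add: top.extremum_unique)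
  moreover have "card (g ` B) = card B"
    using inj_on_subset[OF assms(2)] by (intro card_image) auto
  ultimately show ?thesis
    using B(3) dim_span_eq_card_independent[of "g ` B"] by simp
qed

section \<open>Quadratic factors of real polynomials\<close>

lemma map_poly_of_real_add:
  "map_poly complex_of_real (p + q) = map_poly complex_of_real p + map_poly complex_of_real q"
  by (rule poly_eqI) (simp add: coeff_map_poly)

lemma map_poly_of_real_mult:
  "map_poly complex_of_real (p * q) = map_poly complex_of_real p * map_poly complex_of_real q"
  by (induction p) (simp_all add: map_poly_of_real_add map_poly_pCons map_poly_smult)

text \<open>
A complex root \<open>z\<close> gives the factor: \<open>X - z\<close> if \<open>z\<close> is real, and otherwise
\<open>X\<^sup>2 - 2 Re z X + \<bar>z\<bar>\<^sup>2\<close>, because a real polynomial of degree at most one with a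
non-real root vanishes. The coefficient \<open>c\<close> is zero in the first case, so both cases share the
shape \<open>[:a, b, c:]\<close>.
\<close>

lemma real_poly_quadratic_factor:
  fixes p :: "real poly"
  assumes "degree p > 0"
  obtains a b c s where "p = [:a, b, c:] * s" "b \<noteq> 0 \<or> c \<noteq> 0" "degree s < degree p"
proof -
  let ?P = "\<lambda>p. poly (map_poly complex_of_real p)"
  have "degree (map_poly complex_of_real p) = degree p"
    by (rule map_poly_degree_eq) (use assms in auto)
  then have "\<not> constant (poly (map_poly complex_of_real p))"
    using assms by (simp add: constant_degree)
  then obtain z where z: "?P p z = 0"
    using fundamental_theorem_of_algebra by blast
  have "\<exists>a b c s. p = [:a, b, c:] * s \<and> (b \<noteq> 0 \<or> c \<noteq> 0)"
  proof (cases "Im z = 0")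
    case True
    then have "z = complex_of_real (Re z)"
      by (simp add: complex_eq_iff)
    moreover have "?P p (complex_of_real x) = complex_of_real (poly p x)" for x
      by (induction p) (simp_all add: map_poly_pCons)
    ultimately have "poly p (Re z) = 0"
      using z by (metis of_real_eq_0_iff)
    then have "[:- Re z, 1, 0:] dvd p"
      by (simp add: poly_eq_0_iff_dvd)
    then obtain s where "p = [:- Re z, 1, 0:] * s" by (rule dvdE)
    then show ?thesis by (metis zero_neq_one)
  next
    case False
    define q where "q = [:(Re z)\<^sup>2 + (Im z)\<^sup>2, - 2 * Re z, 1:]"
    have qz: "?P q z = 0"
      by (simp add: q_def map_poly_pCons complex_eq_iff power2_eq_square algebra_simps)
    define r where "r = p mod q"
    have "r = 0 \<or> degree r < degree q"
      unfolding r_def by (rule degree_mod_less) (simp add: q_def)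
    then have "degree r \<le> 1"
      by (auto simp: q_def)
    then have "r = [:coeff r 0, coeff r 1:]"
      by (intro poly_eqI) (auto simp: coeff_pCons coeff_eq_0 split: nat.split)
    then obtain c d where cd: "r = [:c, d:]" by blast
    have "p = q * (p div q) + r"
      by (simp add: r_def)
    then have "?P p z = ?P q z * ?P (p div q) z + ?P r z"
      by (metis map_poly_of_real_add map_poly_of_real_mult poly_add poly_mult)
    then have "?P r z = 0"
      using z qz by simp
    then have "d = 0 \<and> c = 0"
      using False unfolding cd by (simp add: map_poly_pCons complex_eq_iff) auto
    then have "p = q * (p div q)"
      using \<open>p = q * (p div q) + r\<close> cd by simp
    then show ?thesis
      unfolding q_def by (metis zero_neq_one)
  qed
  then obtain a b c s where *: "p = [:a, b, c:] * s" "b \<noteq> 0 \<or> c \<noteq> 0" by blast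
  have "degree p = degree [:a, b, c:] + degree s"
    using * assms by (subst *(1), subst degree_mult_eq) auto
  moreover have "degree [:a, b, c:] > 0"
    using *(2) by auto
  ultimately show ?thesis
    using * that by simp
qed

section \<open>Division algebras carried by a subspace\<close>

lemma eq_neg_self_imp_zero:
  fixes x :: "'a::real_vector"
  assumes "x = - x"
  shows "x = 0"
proof -
  have "2 *\<^sub>R x = 0"
    using assms by (simp add: scaleR_2 eq_neg_iff_add_eq_0)
  then show ?thesis by simp
qed

text \<open>
The product lives on a subspace of a given vector space, not on a type, because the division
algebra of an L-algebra will be carried by the range of one of its operators, which depends on the
algebra. Outside \<open>V\<close> nothing is known about the product.
\<close>

locale division_algebra_on =
  fixes V :: "'a::real_vector set" and m :: "'a \<Rightarrow> 'a \<Rightarrow> 'a" (infixl "\<cdot>" 70) and e :: 'a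
  assumes subspace_V: "subspace V" and finite_dim_V: "finite_dim V"
    and e_in [simp]: "e \<in> V" and e_nonzero: "e \<noteq> 0"
    and mult_in [simp]: "x \<in> V \<Longrightarrow> y \<in> V \<Longrightarrow> x \<cdot> y \<in> V"
    and add_mult: "x \<in> V \<Longrightarrow> y \<in> V \<Longrightarrow> z \<in> V \<Longrightarrow> (x + y) \<cdot> z = x \<cdot> z + y \<cdot> z"
    and mult_add: "x \<in> V \<Longrightarrow> y \<in> V \<Longrightarrow> z \<in> V \<Longrightarrow> x \<cdot> (y + z) = x \<cdot> y + x \<cdot> z"
    and scale_mult: "x \<in> V \<Longrightarrow> y \<in> V \<Longrightarrow> (c *\<^sub>R x) \<cdot> y = c *\<^sub>R (x \<cdot> y)"
    and mult_scale: "x \<in> V \<Longrightarrow> y \<in> V \<Longrightarrow> x \<cdot> (c *\<^sub>R y) = c *\<^sub>R (x \<cdot> y)"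
    and mult_assoc: "x \<in> V \<Longrightarrow> y \<in> V \<Longrightarrow> z \<in> V \<Longrightarrow> x \<cdot> y \<cdot> z = x \<cdot> (y \<cdot> z)"
    and e_mult [simp]: "x \<in> V \<Longrightarrow> e \<cdot> x = x"
    and mult_e [simp]: "x \<in> V \<Longrightarrow> x \<cdot> e = x"
    and no_zero_divisors: "x \<in> V \<Longrightarrow> y \<in> V \<Longrightarrow> x \<cdot> y = 0 \<Longrightarrow> x = 0 \<or> y = 0"
begin

lemma vector_in [simp]:
  "0 \<in> V"
  "x \<in> V \<Longrightarrow> y \<in> V \<Longrightarrow> x + y \<in> V"
  "x \<in> V \<Longrightarrow> y \<in> V \<Longrightarrow> x - y \<in> V"
  "x \<in> V \<Longrightarrow> - x \<in> V"
  "x \<in> V \<Longrightarrow> c *\<^sub>R x \<in> V"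
  using subspace_V by (simp_all add: subspace_0 subspace_add subspace_diff subspace_neg subspace_scale)

lemma neg_mult: "x \<in> V \<Longrightarrow> y \<in> V \<Longrightarrow> (- x) \<cdot> y = - (x \<cdot> y)"
  and mult_neg: "x \<in> V \<Longrightarrow> y \<in> V \<Longrightarrow> x \<cdot> (- y) = - (x \<cdot> y)"
  using scale_mult[of x y "-1"] mult_scale[of x y "-1"] by simp_all

lemma zero_mult [simp]: "x \<in> V \<Longrightarrow> 0 \<cdot> x = 0"
  and mult_zero [simp]: "x \<in> V \<Longrightarrow> x \<cdot> 0 = 0"
  using scale_mult[of x x 0] mult_scale[of x x 0] by simp_all

lemma diff_mult: "x \<in> V \<Longrightarrow> y \<in> V \<Longrightarrow> z \<in> V \<Longrightarrow> (x - y) \<cdot> z = x \<cdot> z - y \<cdot> z"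
  and mult_diff: "x \<in> V \<Longrightarrow> y \<in> V \<Longrightarrow> z \<in> V \<Longrightarrow> x \<cdot> (y - z) = x \<cdot> y - x \<cdot> z"
  using add_mult[of x "- y" z] mult_add[of x y "- z"] by (simp_all add: neg_mult mult_neg)

lemmas mult_simps = add_mult mult_add scale_mult mult_scale neg_mult mult_neg diff_mult mult_diff

section \<open>Elements of a division algebra are quadratic\<close>

text \<open>
The value \<open>p(x)\<close> by Horner's scheme, where a constant \<open>a\<close> stands for \<open>a *\<^sub>R e\<close>.
\<close>

definition eval_at :: "'a \<Rightarrow> real poly \<Rightarrow> 'a" where
  "eval_at x p = fold_coeffs (\<lambda>a v. a *\<^sub>R e + x \<cdot> v) p 0"

lemma eval_at_0 [simp]: "eval_at x 0 = 0"
  by (simp add: eval_at_def)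

lemma eval_at_pCons: "x \<in> V \<Longrightarrow> eval_at x (pCons a p) = a *\<^sub>R e + x \<cdot> eval_at x p"
  by (cases "a = 0 \<and> p = 0") (auto simp: eval_at_def)

lemma eval_at_in [simp]: "x \<in> V \<Longrightarrow> eval_at x p \<in> V"
  by (induction p) (simp_all add: eval_at_pCons)

lemma eval_at_add: "x \<in> V \<Longrightarrow> eval_at x (p + q) = eval_at x p + eval_at x q"
  by (induction p q rule: poly_induct2) (simp_all add: eval_at_pCons mult_simps algebra_simps)

lemma eval_at_smult: "x \<in> V \<Longrightarrow> eval_at x (smult c p) = c *\<^sub>R eval_at x p"
  by (induction p) (simp_all add: eval_at_pCons mult_simps algebra_simps)

lemma eval_at_mult: "x \<in> V \<Longrightarrow> eval_at x (p * q) = eval_at x p \<cdot> eval_at x q"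
  by (induction p)
    (simp_all add: eval_at_pCons eval_at_add eval_at_smult mult_simps mult_assoc)

lemma eval_at_sum:
  assumes "x \<in> V"
  shows "eval_at x (\<Sum>i\<in>I. p i) = (\<Sum>i\<in>I. eval_at x (p i))"
  by (induction I rule: infinite_finite_induct) (simp_all add: eval_at_add assms)

text \<open>
The powers of \<open>x\<close> cannot be infinitely many independent vectors of the finite-dimensional space
\<open>V\<close>: either two of them coincide or they satisfy a linear relation, and each case yields a
polynomial.
\<close>

lemma annihilating_poly:
  assumes x: "x \<in> V"
  shows "\<exists>p. p \<noteq> 0 \<and> eval_at x p = 0"
proof -
  let ?pw = "\<lambda>i. eval_at x (monom 1 i)"
  show ?thesis
  proof (cases "inj ?pw")
    case False
    then obtain i j where ij: "i \<noteq> j" "?pw i = ?pw j"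
      unfolding inj_on_def by blast
    have "eval_at x (monom 1 i - monom 1 j) = ?pw i - ?pw j"
      using eval_at_add[OF x, of "monom 1 i" "smult (-1) (monom 1 j)"]
        eval_at_smult[OF x, of "-1" "monom 1 j"] by simp
    moreover have "coeff (monom (1::real) i - monom 1 j) i \<noteq> 0"
      using ij(1) by simp
    ultimately show ?thesis
      using ij(2) by (metis cancel_comm_monoid_add_class.diff_cancel coeff_0)
  next
    case True
    have "infinite (range ?pw)"
      using True by (simp add: finite_image_iff)
    moreover have "range ?pw \<subseteq> V"
      using x by auto
    ultimately have "dependent (range ?pw)"
      using independent_in_finite_dim finite_dim_V by blast
    then obtain S u where S: "finite S" "S \<subseteq> range ?pw" "(\<Sum>v\<in>S. u v *\<^sub>R v) = 0" "\<exists>v\<in>S. u v \<noteq> 0"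
      unfolding dependent_explicit by blast
    define I where "I = ?pw -` S"
    have I: "finite I" "?pw ` I = S"
      using S(1,2) True unfolding I_def by (auto intro: finite_vimageI)
    define p where "p = (\<Sum>i\<in>I. smult (u (?pw i)) (monom 1 i))"
    have "eval_at x p = (\<Sum>i\<in>I. u (?pw i) *\<^sub>R ?pw i)"
      by (simp only: p_def eval_at_sum[OF x] eval_at_smult[OF x])
    also have "\<dots> = (\<Sum>v\<in>?pw ` I. u v *\<^sub>R v)"
      using inj_on_subset[OF True subset_UNIV, of I] by (simp add: sum.reindex)
    also have "\<dots> = 0"
      using S(3) I(2) by simp
    finally have "eval_at x p = 0" .
    moreover obtain k where k: "k \<in> I" "u (?pw k) \<noteq> 0"
      using S(4) I(2) by auto
    have "coeff p k = u (?pw k)"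
      using I(1) k(1) by (simp add: p_def coeff_sum sum.delta' if_distrib[of "\<lambda>t. _ * t"] cong: if_cong)
    then have "p \<noteq> 0"
      using k(2) by auto
    ultimately show ?thesis by blast
  qed
qed

text \<open>
An annihilating polynomial splits off a factor of degree one or two. Without zero divisors either
this factor or the cofactor annihilates \<open>x\<close>, so by induction on the degree some nonconstant
factor of degree at most two does. A linear factor makes \<open>x\<close> a real multiple of \<open>e\<close>, which also
has the stated form.
\<close>

lemma quadratic:
  assumes x: "x \<in> V"
  shows "\<exists>a b. x \<cdot> x = a *\<^sub>R x + b *\<^sub>R e"
proof -
  have "\<exists>a b. x \<cdot> x = a *\<^sub>R x + b *\<^sub>R e" if "p \<noteq> 0" "eval_at x p = 0" for p
    using that
  proof (induction "degree p" arbitrary: p rule: less_induct)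
    case less
    have "degree p > 0"
    proof (rule ccontr)
      assume "\<not> degree p > 0"
      then obtain c where "p = [:c:]"
        by (metis degree_eq_zeroE not_gr0)
      then show False
        using less.prems e_nonzero x by (simp add: eval_at_pCons)
    qed
    then obtain a b c s where s: "p = [:a, b, c:] * s" "b \<noteq> 0 \<or> c \<noteq> 0"
      "degree s < degree p"
      by (rule real_poly_quadratic_factor)
    have "eval_at x [:a, b, c:] = 0 \<or> eval_at x s = 0"
    proof (rule no_zero_divisors)
      show "eval_at x [:a, b, c:] \<cdot> eval_at x s = 0"
        using less.prems(2) unfolding s(1) eval_at_mult[OF x] .
    qed (use x in simp_all)
    then show ?case
    proof
      assume "eval_at x s = 0"
      moreover have "s \<noteq> 0" using s(1) less.prems(1) by auto
      ultimately show ?thesis using less.hyps s(3) by blast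
    next
      assume "eval_at x [:a, b, c:] = 0"
      then have eq: "a *\<^sub>R e + b *\<^sub>R x + c *\<^sub>R (x \<cdot> x) = 0"
        using x by (simp add: eval_at_pCons mult_simps algebra_simps)
      show ?thesis
      proof (cases "c = 0")
        case True
        then have "b \<noteq> 0" and "b *\<^sub>R x = - (a *\<^sub>R e)"
          using eq s(2) by (simp_all add: add_eq_0_iff)
        then have "inverse b *\<^sub>R (b *\<^sub>R x) = (- a / b) *\<^sub>R e"
          by (simp add: divide_inverse_commute)
        then have "x = (- a / b) *\<^sub>R e"
          using \<open>b \<noteq> 0\<close> by simp
        then have "x \<cdot> x = (- a / b) *\<^sub>R x + 0 *\<^sub>R e"
          using x scale_mult[of e x "- a / b"] by simp
        then show ?thesis by blast
      next
        case False
        have "c *\<^sub>R (x \<cdot> x) = - (a *\<^sub>R e + b *\<^sub>R x)"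
          using eq by (simp only: add_eq_0_iff)
        then have "inverse c *\<^sub>R (c *\<^sub>R (x \<cdot> x)) = inverse c *\<^sub>R (- (a *\<^sub>R e + b *\<^sub>R x))"
          by (simp only:)
        then have "x \<cdot> x = (inverse c * (- b)) *\<^sub>R x + (inverse c * (- a)) *\<^sub>R e"
          using False by (simp add: scaleR_diff_right)
        then show ?thesis by blast
      qed
    qed
  qed
  then show ?thesis
    using annihilating_poly[OF x] by blast
qed

section \<open>Imaginary units\<close>

text \<open>
If \<open>d \<ge> 0\<close>, then \<open>y\<^sup>2 - d = (y - \<surd>d) (y + \<surd>d)\<close> vanishes only for a real multiple of \<open>e\<close>; so
\<open>d < 0\<close>, and dividing \<open>y\<close> by \<open>\<surd>(-d)\<close> gives a square root of \<open>-e\<close>.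
\<close>

lemma normalise_imaginary:
  assumes y: "y \<in> V" "y \<cdot> y = d *\<^sub>R e" and nonreal: "\<And>a. y \<noteq> a *\<^sub>R e"
  obtains c i where "c \<noteq> 0" "i \<in> V" "i \<cdot> i = - e" "y = c *\<^sub>R i"
proof -
  have "d < 0"
  proof (rule ccontr)
    assume "\<not> d < 0"
    then have "(y - sqrt d *\<^sub>R e) \<cdot> (y + sqrt d *\<^sub>R e) = 0"
      using y by (simp add: mult_simps scaleR_diff_right)
    then have "y - sqrt d *\<^sub>R e = 0 \<or> y + sqrt d *\<^sub>R e = 0"
      using y by (intro no_zero_divisors) simp_all
    then have "y = sqrt d *\<^sub>R e \<or> y = (- sqrt d) *\<^sub>R e"
      by (simp add: eq_neg_iff_add_eq_0)
    then show False using nonreal by blast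
  qed
  define c where "c = sqrt (- d)"
  have c: "c \<noteq> 0" "c * c = - d"
    using \<open>d < 0\<close> by (simp_all add: c_def)
  have "(inverse c *\<^sub>R y) \<cdot> (inverse c *\<^sub>R y) = (inverse (c * c) * d) *\<^sub>R e"
    using y by (simp add: mult_simps)
  also have "\<dots> = - e"
    using c(2) \<open>d < 0\<close> by simp
  finally show ?thesis
    using that[of c "inverse c *\<^sub>R y"] c(1) y(1) by simp
qed

text \<open>
Completing the square in the quadratic relation for \<open>x\<close> reduces this to
\<open>normalise_imaginary\<close>.
\<close>

lemma imaginary_unit:
  assumes x: "x \<in> V" and nonreal: "\<And>a. x \<noteq> a *\<^sub>R e"
  obtains a c i where "c \<noteq> 0" "i \<in> V" "i \<cdot> i = - e" "x = a *\<^sub>R e + c *\<^sub>R i"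
proof -
  obtain a b where ab: "x \<cdot> x = a *\<^sub>R x + b *\<^sub>R e"
    using quadratic[OF x] by blast
  let ?y = "x - (a / 2) *\<^sub>R e"
  have "a *\<^sub>R x = (a / 2) *\<^sub>R x + (a / 2) *\<^sub>R x"
    by (subst scaleR_add_left[symmetric]) simp
  then have "?y \<cdot> ?y = (b + a * a / 4) *\<^sub>R e"
    using x by (simp add: mult_simps ab scaleR_diff_right scaleR_add_left)
  moreover have "?y \<noteq> t *\<^sub>R e" for t
    using nonreal[of "t + a / 2"] by (auto simp: algebra_simps)
  ultimately obtain c i where "c \<noteq> 0" "i \<in> V" "i \<cdot> i = - e" "?y = c *\<^sub>R i"
    using normalise_imaginary[of ?y] x by (metis vector_in(3,5) e_in)
  then show ?thesis
    using that[of c i "a / 2"] by (simp add: algebra_simps)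
qed

text \<open>
A copy \<open>span {e, i}\<close> of the complex numbers is its own centralizer: if \<open>j\<close> is another square root
of \<open>-e\<close> that commutes with \<open>i\<close>, then \<open>(j - i) (j + i) = 0\<close>, so \<open>j = i\<close> or \<open>j = -i\<close>.
\<close>

lemma centralizer_of_unit:
  assumes i: "i \<in> V" "i \<cdot> i = - e" and u: "u \<in> V" "i \<cdot> u = u \<cdot> i"
  obtains a b where "u = a *\<^sub>R e + b *\<^sub>R i"
proof (cases "\<exists>a. u = a *\<^sub>R e")
  case True
  then obtain a where "u = a *\<^sub>R e + 0 *\<^sub>R i" by auto
  then show ?thesis by (rule that)
next
  case False
  then obtain a c j where j: "c \<noteq> 0" "j \<in> V" "j \<cdot> j = - e" "u = a *\<^sub>R e + c *\<^sub>R j"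
    using imaginary_unit[OF u(1)] by metis
  have "c *\<^sub>R (i \<cdot> j) = c *\<^sub>R (j \<cdot> i)"
    using u(2) i(1) j(2) unfolding j(4) by (simp add: mult_simps)
  then have ij: "i \<cdot> j = j \<cdot> i"
    using j(1) by simp
  have "(j - i) \<cdot> (j + i) = 0"
    using i j(2,3) ij by (simp add: mult_simps)
  then have "j - i = 0 \<or> j + i = 0"
    using i(1) j(2) by (intro no_zero_divisors) simp_all
  then have "u = a *\<^sub>R e + c *\<^sub>R i \<or> u = a *\<^sub>R e + (- c) *\<^sub>R i"
    unfolding j(4) by (auto simp: add_eq_0_iff2)
  then show ?thesis using that by blast
qed

section \<open>Frobenius' theorem\<close>

definition algebra_iso :: "('b::real_algebra_1 \<Rightarrow> 'a) \<Rightarrow> bool" where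
  "algebra_iso f \<longleftrightarrow> bij_betw f UNIV V \<and> linear f \<and> (\<forall>a b. f (a * b) = f a \<cdot> f b) \<and> f 1 = e"

text \<open>
A unital homomorphism from a division algebra is injective, since a nonzero kernel element would
have an inverse and so kill \<open>1\<close>.
\<close>

lemma algebra_isoI:
  fixes f :: "'b::real_div_algebra \<Rightarrow> 'a"
  assumes "linear f" "\<And>a b. f (a * b) = f a \<cdot> f b" "f 1 = e" "\<And>a. f a \<in> V"
    and surj: "\<And>v. v \<in> V \<Longrightarrow> \<exists>a. v = f a"
  shows "algebra_iso f"
proof -
  have "a = 0" if "f a = 0" for a
  proof (rule ccontr)
    assume "a \<noteq> 0"
    then have "e = f a \<cdot> f (inverse a)"
      using assms(2)[of a "inverse a"] assms(3) by simp
    then show False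
      using that assms(4) e_nonzero by simp
  qed
  then have "inj f"
    using assms(1) linear_injective_0 by blast
  moreover have "range f = V"
    using assms(4) surj by blast
  ultimately show ?thesis
    using assms unfolding algebra_iso_def bij_betw_def by blast
qed

text \<open>
If every element is real, \<open>V\<close> is \<open>\<real>\<close>. Otherwise there is a square root \<open>i\<close> of \<open>-e\<close>, and if
\<open>span {e, i}\<close> is everything, \<open>V\<close> is the complex field. In the remaining case, conjugation by \<open>i\<close>
is an involution that splits \<open>V\<close> into the centralizer of \<open>i\<close>, which is \<open>span {e, i}\<close>, and the
elements that anticommute with \<open>i\<close>. A nonzero anticommuting element has a real square and can be
normalised to \<open>j\<close> with \<open>j\<^sup>2 = -e\<close>; multiplication by \<open>j\<close> exchanges the two parts, so
\<open>e, i, j, ij\<close> span \<open>V\<close>, and they multiply like the quaternion units.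
\<close>

theorem frobenius:
  "(\<exists>f :: real \<Rightarrow> 'a. algebra_iso f) \<or> (\<exists>f :: complex \<Rightarrow> 'a. algebra_iso f) \<or>
   (\<exists>f :: quat \<Rightarrow> 'a. algebra_iso f)"
proof (cases "\<forall>x\<in>V. \<exists>a. x = a *\<^sub>R e")
  case True
  have "algebra_iso (\<lambda>a :: real. a *\<^sub>R e)"
    by (rule algebra_isoI) (use True in \<open>auto simp: mult_simps linear_iff scaleR_add_left\<close>)
  then show ?thesis by blast
next
  case False
  then obtain i where i [simp]: "i \<in> V" and ii: "i \<cdot> i = - e"
    using imaginary_unit by metis
  show ?thesis
  proof (cases "\<forall>x\<in>V. \<exists>a b. x = a *\<^sub>R e + b *\<^sub>R i")
    case True
    have "algebra_iso (\<lambda>z. Re z *\<^sub>R e + Im z *\<^sub>R i)"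
    proof (rule algebra_isoI)
      fix v assume "v \<in> V"
      then obtain a b where "v = a *\<^sub>R e + b *\<^sub>R i" using True by blast
      then show "\<exists>z. v = Re z *\<^sub>R e + Im z *\<^sub>R i"
        by (intro exI[of _ "Complex a b"]) simp
    qed (simp_all add: linear_iff mult_simps ii algebra_simps)
    then show ?thesis by blast
  next
    case False
    then obtain v where v [simp]: "v \<in> V" and v_notin: "\<And>a b. v \<noteq> a *\<^sub>R e + b *\<^sub>R i"
      by blast
    have i_i: "i \<cdot> (i \<cdot> x) = - x" if "x \<in> V" for x
      using that mult_assoc[of i i x] by (simp add: ii neg_mult)
    \<comment> \<open>twice the anticommuting component of \<open>v\<close>\<close>
    define w where "w = v + i \<cdot> v \<cdot> i"
    have w [simp]: "w \<in> V" by (simp add: w_def)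
    have anti: "i \<cdot> w = - (w \<cdot> i)"
      by (simp add: w_def mult_simps mult_assoc ii i_i)
    have w_nonreal: "w \<noteq> a *\<^sub>R e" for a
    proof
      assume a: "w = a *\<^sub>R e"
      then have "a *\<^sub>R i = - (a *\<^sub>R i)"
        using anti by (simp add: mult_simps)
      then have "a *\<^sub>R i = 0"
        by (rule eq_neg_self_imp_zero)
      moreover have "i \<noteq> 0"
        using ii e_nonzero by auto
      ultimately have "w = 0"
        using a by simp
      then have "i \<cdot> w = 0" by simp
      then have "i \<cdot> v = v \<cdot> i"
        by (simp add: w_def mult_simps mult_assoc i_i)
      then show False
        using centralizer_of_unit[OF i ii v] v_notin by metis
    qed
    obtain a b where ab: "w \<cdot> w = a *\<^sub>R w + b *\<^sub>R e"
      using quadratic[OF w] by blast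
    \<comment> \<open>\<open>w\<^sup>2\<close> commutes with \<open>i\<close> whereas \<open>w\<close> anticommutes, so the linear coefficient \<open>a\<close> drops out\<close>
    have "i \<cdot> (w \<cdot> w) = (w \<cdot> w) \<cdot> i"
      using anti by (simp add: mult_assoc[symmetric] neg_mult) (simp add: mult_assoc mult_neg)
    then have "a *\<^sub>R (w \<cdot> i) = - (a *\<^sub>R (w \<cdot> i))"
      unfolding ab by (simp add: mult_simps anti)
    then have "a *\<^sub>R (w \<cdot> i) = 0"
      by (rule eq_neg_self_imp_zero)
    moreover have "w \<cdot> i \<noteq> 0"
      using no_zero_divisors[of w i] w_nonreal[of 0] ii e_nonzero by auto
    ultimately have "w \<cdot> w = b *\<^sub>R e"
      using ab by simp
    then obtain c j where j: "c \<noteq> 0" "j \<in> V" "j \<cdot> j = - e" "w = c *\<^sub>R j"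
      using normalise_imaginary[OF w _ w_nonreal] by metis
    note [simp] = j(2)
    define k where "k = i \<cdot> j"
    have k [simp]: "k \<in> V" by (simp add: k_def)
    have ji: "j \<cdot> i = - k"
    proof -
      have "c *\<^sub>R (i \<cdot> j) = c *\<^sub>R (- (j \<cdot> i))"
        using anti unfolding j(4) by (simp add: mult_simps)
      then have "i \<cdot> j = - (j \<cdot> i)"
        using j(1) by (simp only: scaleR_cancel_left) simp
      then show ?thesis by (simp add: k_def)
    qed
    have ij: "i \<cdot> j = k" by (simp add: k_def)
    have j_j: "x \<cdot> j \<cdot> j = - x" if "x \<in> V" for x
      using that by (simp add: mult_assoc j(3) mult_neg)
    have ik: "i \<cdot> k = - j"
      by (simp add: k_def i_i)
    have ki: "k \<cdot> i = j"
      unfolding k_def by (simp add: mult_assoc ji mult_neg ik)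
    have kj: "k \<cdot> j = - i"
      by (simp add: k_def j_j)
    have jk: "j \<cdot> k = i"
      unfolding k_def by (simp add: mult_assoc[symmetric] ji neg_mult kj)
    have kk: "k \<cdot> k = - e"
      using mult_assoc[of i j k] by (simp add: ij jk ii)
    note table = ii j(3) kk ij ji ik ki jk kj
    have "algebra_iso (\<lambda>q. qre q *\<^sub>R e + qi q *\<^sub>R i + qj q *\<^sub>R j + qk q *\<^sub>R k)"
    proof (rule algebra_isoI)
      fix x assume x [simp]: "x \<in> V"
      \<comment> \<open>\<open>x\<close> is half the sum of a part commuting with \<open>i\<close> and a part \<open>y\<close> anticommuting with it\<close>
      have "i \<cdot> (x - i \<cdot> x \<cdot> i) = (x - i \<cdot> x \<cdot> i) \<cdot> i"
        by (simp add: mult_simps mult_assoc ii i_i)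
      then obtain a b where ab: "x - i \<cdot> x \<cdot> i = a *\<^sub>R e + b *\<^sub>R i"
        using centralizer_of_unit[OF i ii, of "x - i \<cdot> x \<cdot> i"] by (metis i mult_in vector_in(3) x)
      define y where "y = x + i \<cdot> x \<cdot> i"
      have y [simp]: "y \<in> V" by (simp add: y_def)
      have "i \<cdot> y = - (y \<cdot> i)"
        by (simp add: y_def mult_simps mult_assoc ii i_i)
      then have "i \<cdot> (y \<cdot> j) = (y \<cdot> j) \<cdot> i"
        using mult_assoc[of i y j] by (simp add: mult_assoc ji ij mult_simps)
      then obtain c d where "y \<cdot> j = c *\<^sub>R e + d *\<^sub>R i"
        using centralizer_of_unit[OF i ii, of "y \<cdot> j"] by (metis j(2) mult_in y)
      then have "y \<cdot> j \<cdot> j = c *\<^sub>R j + d *\<^sub>R k"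
        by (simp add: mult_simps ij)
      then have "y = - (c *\<^sub>R j + d *\<^sub>R k)"
        using j_j[OF y] by (metis minus_minus)
      moreover have "2 *\<^sub>R x = (x - i \<cdot> x \<cdot> i) + y"
        by (simp add: y_def scaleR_2)
      ultimately have "(1/2) *\<^sub>R (2 *\<^sub>R x) = (1/2) *\<^sub>R (a *\<^sub>R e + b *\<^sub>R i - (c *\<^sub>R j + d *\<^sub>R k))"
        by (simp only: ab) simp
      then have "x = (a / 2) *\<^sub>R e + (b / 2) *\<^sub>R i + (- c / 2) *\<^sub>R j + (- d / 2) *\<^sub>R k"
        by (simp add: algebra_simps)
      then show "\<exists>q. x = qre q *\<^sub>R e + qi q *\<^sub>R i + qj q *\<^sub>R j + qk q *\<^sub>R k"
        by (intro exI[of _ "Quat (a / 2) (b / 2) (- c / 2) (- d / 2)"]) simp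
    next
      fix p q :: quat
      show "qre (p * q) *\<^sub>R e + qi (p * q) *\<^sub>R i + qj (p * q) *\<^sub>R j + qk (p * q) *\<^sub>R k =
        (qre p *\<^sub>R e + qi p *\<^sub>R i + qj p *\<^sub>R j + qk p *\<^sub>R k) \<cdot>
        (qre q *\<^sub>R e + qi q *\<^sub>R i + qj q *\<^sub>R j + qk q *\<^sub>R k)"
        by (simp add: times_quat_def mult_simps table algebra_simps)
    qed (simp_all add: linear_iff plus_quat_def scaleR_quat_def one_quat_def algebra_simps)
    then show ?thesis by blast
  qed
qed

end

lemma dim_quat: "dim (UNIV :: quat set) = 4"
proof (rule dim_unique)
  let ?B = "{Quat 1 0 0 0, Quat 0 1 0 0, Quat 0 0 1 0, Quat 0 0 0 1}"
  show "UNIV \<subseteq> span ?B"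
  proof
    fix q :: quat
    have "q = qre q *\<^sub>R Quat 1 0 0 0 + qi q *\<^sub>R Quat 0 1 0 0 + qj q *\<^sub>R Quat 0 0 1 0 + qk q *\<^sub>R Quat 0 0 0 1"
      by (simp add: plus_quat_def scaleR_quat_def)
    also have "\<dots> \<in> span ?B"
      by (intro span_add span_scale span_base) auto
    finally show "q \<in> span ?B" .
  qed
  show "independent ?B"
    by (auto simp: dependent_finite plus_quat_def scaleR_quat_def zero_quat_def)
qed auto

section \<open>Bounded operators and subspaces\<close>

lemma subspace_closure:
  fixes V :: "'a::real_normed_vector set"
  assumes "subspace V"
  shows "subspace (closure V)"
  unfolding subspace_def
proof (intro conjI ballI allI)
  show "0 \<in> closure V"
    using assms closure_subset subspace_0 by blast
next
  fix x y assume "x \<in> closure V" "y \<in> closure V"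
  then obtain f g where "\<forall>n. f n \<in> V" "f \<longlonglongrightarrow> x" "\<forall>n. g n \<in> V" "g \<longlonglongrightarrow> y"
    unfolding closure_sequential by blast
  then have "(\<forall>n. f n + g n \<in> V) \<and> (\<lambda>n. f n + g n) \<longlonglongrightarrow> x + y"
    using assms by (simp add: subspace_add tendsto_add)
  then show "x + y \<in> closure V"
    unfolding closure_sequential by (intro exI)
next
  fix c x assume "x \<in> closure V"
  then obtain f where "\<forall>n. f n \<in> V" "f \<longlonglongrightarrow> x"
    unfolding closure_sequential by blast
  then have "(\<forall>n. c *\<^sub>R f n \<in> V) \<and> (\<lambda>n. c *\<^sub>R f n) \<longlonglongrightarrow> c *\<^sub>R x"
    using assms by (simp add: subspace_scale tendsto_scaleR)
  then show "c *\<^sub>R x \<in> closure V"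
    unfolding closure_sequential by (intro exI)
qed

lemma linear_blinfun_apply: "linear (blinfun_apply T)"
  by (rule bounded_linear.linear[OF blinfun.bounded_linear_right])

lemma subspace_range_blinfun: "subspace (range (blinfun_apply T))"
  by (intro linear_subspace_image linear_blinfun_apply subspace_UNIV)

section \<open>The finite rank part of an L-algebra acts irreducibly\<close>

locale l_algebra =
  fixes A :: "('a::real_normed_vector \<Rightarrow>\<^sub>L 'a) set"
  assumes L_algebra: "L_algebra A"
begin

lemma subspace_A: "subspace A"
  and compose_A: "S \<in> A \<Longrightarrow> T \<in> A \<Longrightarrow> S o\<^sub>L T \<in> A"
  and transitive_A: "closed M \<Longrightarrow> subspace M \<Longrightarrow> (\<And>T x. T \<in> A \<Longrightarrow> x \<in> M \<Longrightarrow> blinfun_apply T x \<in> M)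
      \<Longrightarrow> M = {0} \<or> M = UNIV"
  using L_algebra unfolding L_algebra_def operator_algebra_def transitive_algebra_def
  by (simp_all add: image_subset_iff)

lemma fin_part_nonzero: obtains T where "T \<in> fin_part A" "T \<noteq> 0"
  using L_algebra unfolding L_algebra_def fin_part_def by blast

lemma fin_part_in_A: "T \<in> fin_part A \<Longrightarrow> T \<in> A"
  by (simp add: fin_part_def)

lemma fin_part_finite_dim: "T \<in> fin_part A \<Longrightarrow> finite_dim (range (blinfun_apply T))"
  by (simp add: fin_part_def finite_rank_def)

lemma compose_fin_part_left:
  assumes "S \<in> A" "T \<in> fin_part A"
  shows "S o\<^sub>L T \<in> fin_part A"
proof -
  have "finite_dim (blinfun_apply S ` range (blinfun_apply T))"
    using assms(2) by (intro finite_dim_linear_image linear_blinfun_apply fin_part_finite_dim)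
  then show ?thesis
    using assms compose_A by (simp add: fin_part_def finite_rank_def image_image)
qed

lemma compose_fin_part_right:
  assumes "S \<in> A" "T \<in> fin_part A"
  shows "T o\<^sub>L S \<in> fin_part A"
proof -
  have "finite_dim (range (blinfun_apply (T o\<^sub>L S)))"
    by (rule finite_dim_mono[OF fin_part_finite_dim[OF assms(2)]]) auto
  then show ?thesis
    using assms compose_A by (simp add: fin_part_def finite_rank_def)
qed

lemma subspace_fin_part: "subspace (fin_part A)"
  unfolding subspace_def
proof (intro conjI ballI allI)
  have "finite_dim (range (blinfun_apply (0 :: 'a \<Rightarrow>\<^sub>L 'a)))"
    unfolding finite_dim_def by (rule exI[of _ "{}"]) auto
  then show "0 \<in> fin_part A"
    using subspace_A by (simp add: fin_part_def finite_rank_def subspace_0)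
next
  fix S T assume ST: "S \<in> fin_part A" "T \<in> fin_part A"
  obtain B C where BC: "finite B" "range (blinfun_apply S) \<subseteq> span B"
    "finite C" "range (blinfun_apply T) \<subseteq> span C"
    using ST[THEN fin_part_finite_dim] unfolding finite_dim_def by blast
  have "blinfun_apply (S + T) x \<in> span (B \<union> C)" for x
  proof -
    have "blinfun_apply S x \<in> span (B \<union> C)" "blinfun_apply T x \<in> span (B \<union> C)"
      using BC span_mono[of B "B \<union> C"] span_mono[of C "B \<union> C"] by auto
    then show ?thesis
      by (simp add: blinfun.add_left span_add)
  qed
  then have "finite_dim (range (blinfun_apply (S + T)))"
    using BC unfolding finite_dim_def by (intro exI[of _ "B \<union> C"]) auto
  then show "S + T \<in> fin_part A"
    using ST subspace_A by (simp add: fin_part_def finite_rank_def subspace_add)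
next
  fix c T assume T: "T \<in> fin_part A"
  have "finite_dim (range (blinfun_apply (c *\<^sub>R T)))"
    by (rule finite_dim_mono[OF fin_part_finite_dim[OF T]])
      (auto simp: blinfun.scaleR_left blinfun.scaleR_right[symmetric])
  then show "c *\<^sub>R T \<in> fin_part A"
    using T subspace_A by (simp add: fin_part_def finite_rank_def subspace_scale)
qed

lemma orbit_subspace:
  assumes "subspace B"
  shows "subspace ((\<lambda>S. blinfun_apply S x) ` B)"
  by (intro linear_subspace_image assms bounded_linear.linear[OF blinfun.bounded_linear_left])

text \<open>
The closure of the orbit of \<open>x\<close> is invariant, so it is \<open>{0}\<close> or everything. The first is excluded
by transitivity once more, because the vectors killed by the whole of \<open>A\<close> form a closed invariant
subspace as well.
\<close>

lemma orbit_dense: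
  assumes "x \<noteq> 0"
  shows "closure ((\<lambda>S. blinfun_apply S x) ` A) = UNIV"
proof -
  define N where "N = (\<Inter>S\<in>A. {y. blinfun_apply S y = 0})"
  have "closed N"
    unfolding N_def
    by (intro closed_INT ballI closed_Collect_eq continuous_intros)
  moreover have "subspace N"
    unfolding N_def subspace_def by (auto simp: blinfun.add_right blinfun.scaleR_right)
  moreover have "blinfun_apply S y \<in> N" if "S \<in> A" "y \<in> N" for S y
    using that unfolding N_def by (auto simp: blinfun.zero_right)
  ultimately have "N = {0} \<or> N = UNIV"
    by (rule transitive_A)
  moreover have "N \<noteq> UNIV"
  proof
    assume N: "N = UNIV"
    obtain T where T: "T \<in> fin_part A" "T \<noteq> 0"
      by (rule fin_part_nonzero)
    have "blinfun_apply T y = 0" for y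
    proof -
      have "y \<in> N" by (simp add: N)
      then show ?thesis
        unfolding N_def using fin_part_in_A[OF T(1)] by simp
    qed
    then have "T = 0"
      by (intro blinfun_eqI) simp
    with T(2) show False ..
  qed
  ultimately have "x \<notin> N"
    using assms by auto
  then obtain S where S: "S \<in> A" "blinfun_apply S x \<noteq> 0"
    unfolding N_def by auto
  let ?M = "closure ((\<lambda>S. blinfun_apply S x) ` A)"
  have inv: "blinfun_apply T y \<in> ?M" if "T \<in> A" "y \<in> ?M" for T y
  proof -
    have "blinfun_apply T ` ?M \<subseteq> ?M"
    proof (rule image_closure_subset)
      show "blinfun_apply T ` (\<lambda>S. blinfun_apply S x) ` A \<subseteq> ?M"
      proof (rule image_subsetI)
        fix z assume "z \<in> (\<lambda>S. blinfun_apply S x) ` A"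
        then obtain S where S: "S \<in> A" "z = blinfun_apply S x" by blast
        have "blinfun_apply T z \<in> (\<lambda>S. blinfun_apply S x) ` A"
          by (rule image_eqI[of _ _ "T o\<^sub>L S"]) (simp_all add: S compose_A that)
        then show "blinfun_apply T z \<in> ?M"
          by (rule closure_subset[THEN subsetD])
      qed
    qed (auto intro: continuous_intros)
    then show ?thesis using that by blast
  qed
  have "?M = {0} \<or> ?M = UNIV"
    using inv by (intro transitive_A closed_closure subspace_closure orbit_subspace subspace_A)
  moreover have "blinfun_apply S x \<in> ?M"
    by (rule closure_subset[THEN subsetD]) (use S in blast)
  ultimately show ?thesis
    using S by auto
qed

text \<open>
An operator of finite rank turns density into surjectivity: the image of a dense orbit under \<open>T\<close>
is dense in the range of \<open>T\<close>, and as a finite-dimensional subspace it is closed.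
\<close>

lemma orbit_fin_part_range:
  assumes "T \<in> fin_part A" "x \<noteq> 0"
  obtains S where "S \<in> A" "blinfun_apply T (blinfun_apply S x) = blinfun_apply T y"
proof -
  let ?W = "blinfun_apply T ` (\<lambda>S. blinfun_apply S x) ` A"
  have "finite_dim ?W"
    by (rule finite_dim_mono[OF fin_part_finite_dim[OF assms(1)]]) auto
  moreover have "subspace ?W"
    by (intro linear_subspace_image linear_blinfun_apply orbit_subspace subspace_A)
  ultimately have "closed ?W"
    by (intro finite_dim_subspace_closed)
  then have "blinfun_apply T ` closure ((\<lambda>S. blinfun_apply S x) ` A) \<subseteq> ?W"
    by (intro image_closure_subset) (auto intro: continuous_intros)
  then have "blinfun_apply T y \<in> ?W"
    using orbit_dense[OF assms(2)] by auto
  then show ?thesis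
    using that by auto
qed

lemma subspace_fin_space: "subspace (fin_space A)"
  unfolding fin_space_def by (rule subspace_span)

lemma fin_part_apply_in_fin_space: "T \<in> fin_part A \<Longrightarrow> blinfun_apply T x \<in> fin_space A"
  unfolding fin_space_def by (rule span_base) blast

text \<open>
The finite rank operators form an ideal, so \<open>orbit_fin_part_range\<close> puts the range of each of them
into the orbit of \<open>x\<close> under \<open>fin_part A\<close>. Hence \<open>fin_space A\<close> has no nontrivial subspace, closed
or not, that is invariant under this algebra.
\<close>

lemma fin_part_irreducible:
  assumes "x \<noteq> 0" "y \<in> fin_space A"
  obtains T where "T \<in> fin_part A" "blinfun_apply T x = y"
proof -
  have "fin_space A \<subseteq> (\<lambda>S. blinfun_apply S x) ` fin_part A"
    unfolding fin_space_def
  proof (rule span_minimal)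
    show "{blinfun_apply T z |T z. T \<in> fin_part A} \<subseteq> (\<lambda>S. blinfun_apply S x) ` fin_part A"
    proof clarify
      fix T z assume T: "T \<in> fin_part A"
      obtain S where S: "S \<in> A" "blinfun_apply T (blinfun_apply S x) = blinfun_apply T z"
        using orbit_fin_part_range[OF T assms(1)] .
      show "blinfun_apply T z \<in> (\<lambda>S. blinfun_apply S x) ` fin_part A"
        by (rule image_eqI[of _ _ "T o\<^sub>L S"]) (simp_all add: S compose_fin_part_right T)
    qed
  qed (intro orbit_subspace subspace_fin_part)
  then show ?thesis
    using assms(2) that by auto
qed

lemma fin_space_nonzero: obtains x where "x \<in> fin_space A" "x \<noteq> 0"
proof -
  obtain T where T: "T \<in> fin_part A" "T \<noteq> 0" by (rule fin_part_nonzero)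
  then obtain x where "blinfun_apply T x \<noteq> 0"
    by (metis blinfun_eqI zero_blinfun.rep_eq)
  then show ?thesis
    using that fin_part_apply_in_fin_space[OF T(1)] by blast
qed

lemma fin_part_separates:
  assumes "\<And>T. T \<in> fin_part A \<Longrightarrow> blinfun_apply T x = 0"
  shows "x = 0"
proof (rule ccontr)
  assume "x \<noteq> 0"
  obtain y where y: "y \<in> fin_space A" "y \<noteq> 0" by (rule fin_space_nonzero)
  then show False
    using fin_part_irreducible[OF \<open>x \<noteq> 0\<close> y(1)] assms by metis
qed

text \<open>
Commutation with \<open>T\<close> is only known on \<open>fin_space A\<close>. As \<open>T\<close> already takes all of its values
there, operators in the commutant map the range of \<open>T\<close> into itself.
\<close>

lemma fin_part_apply_fin_space:
  assumes "T \<in> fin_part A"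
  obtains x where "x \<in> fin_space A" "blinfun_apply T x = blinfun_apply T y"
proof -
  obtain u where u: "u \<in> fin_space A" "u \<noteq> 0" by (rule fin_space_nonzero)
  obtain G where G: "G \<in> fin_part A" "blinfun_apply G u = u"
    using fin_part_irreducible[OF u(2,1)] .
  obtain S where S: "S \<in> A" "blinfun_apply T (blinfun_apply S u) = blinfun_apply T y"
    using orbit_fin_part_range[OF assms u(2)] .
  have "blinfun_apply (S o\<^sub>L G) u \<in> fin_space A"
    using S(1) G(1) by (intro fin_part_apply_in_fin_space compose_fin_part_left)
  then show ?thesis
    using that S G by simp
qed

section \<open>The algebra structure of the commutant\<close>

lemma commutantD:
  assumes "S \<in> commutant A"
  shows commutant_outside: "x \<notin> fin_space A \<Longrightarrow> S x = 0"
    and commutant_in: "x \<in> fin_space A \<Longrightarrow> S x \<in> fin_space A"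
    and commutant_add: "x \<in> fin_space A \<Longrightarrow> y \<in> fin_space A \<Longrightarrow> S (x + y) = S x + S y"
    and commutant_scale: "x \<in> fin_space A \<Longrightarrow> S (c *\<^sub>R x) = c *\<^sub>R S x"
    and commutant_commutes:
      "T \<in> fin_part A \<Longrightarrow> x \<in> fin_space A \<Longrightarrow> S (blinfun_apply T x) = blinfun_apply T (S x)"
  using assms unfolding commutant_def by blast+

text \<open>
Schur's lemma in the form needed here: an operator in the commutant is determined by its value at
one nonzero vector, since \<open>fin_part A\<close> moves that vector to every point of \<open>fin_space A\<close>.
\<close>

lemma commutant_eqI:
  assumes "S \<in> commutant A" "S' \<in> commutant A" "x \<in> fin_space A" "x \<noteq> 0" "S x = S' x"
  shows "S = S'"
proof
  fix y
  show "S y = S' y"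
  proof (cases "y \<in> fin_space A")
    case True
    then obtain T where "T \<in> fin_part A" "blinfun_apply T x = y"
      using fin_part_irreducible[OF assms(4)] by blast
    then show ?thesis
      using commutant_commutes assms by metis
  qed (simp add: commutant_outside assms)
qed

lemma commutantI:
  assumes "\<And>x. x \<notin> fin_space A \<Longrightarrow> S x = 0"
    and "\<And>x. x \<in> fin_space A \<Longrightarrow> S x \<in> fin_space A"
    and "\<And>x y. x \<in> fin_space A \<Longrightarrow> y \<in> fin_space A \<Longrightarrow> S (x + y) = S x + S y"
    and "\<And>c x. x \<in> fin_space A \<Longrightarrow> S (c *\<^sub>R x) = c *\<^sub>R S x"
    and "\<And>F x. F \<in> fin_part A \<Longrightarrow> x \<in> fin_space A
      \<Longrightarrow> S (blinfun_apply F x) = blinfun_apply F (S x)"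
  shows "S \<in> commutant A"
  unfolding commutant_def using assms by simp

lemma commutant_plus:
  assumes "S \<in> commutant A" "S' \<in> commutant A"
  shows "(\<lambda>x. S x + S' x) \<in> commutant A"
  by (rule commutantI)
    (simp_all add: assms[THEN commutant_outside] assms[THEN commutant_in] assms[THEN commutant_add]
      assms[THEN commutant_scale] assms[THEN commutant_commutes] subspace_fin_space
      subspace_add subspace_scale blinfun.add_right scaleR_add_right)

lemma commutant_scaleR:
  assumes "S \<in> commutant A"
  shows "(\<lambda>x. c *\<^sub>R S x) \<in> commutant A"
  by (rule commutantI)
    (simp_all add: assms[THEN commutant_outside] assms[THEN commutant_in] assms[THEN commutant_add]
      assms[THEN commutant_scale] assms[THEN commutant_commutes] subspace_fin_space
      subspace_add subspace_scale blinfun.scaleR_right scaleR_add_right)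

lemma commutant_comp:
  assumes "S \<in> commutant A" "S' \<in> commutant A"
  shows "S \<circ> S' \<in> commutant A"
proof -
  have "S 0 = 0"
    using commutant_scale[OF assms(1), of 0 0] subspace_0[OF subspace_fin_space] by simp
  then show ?thesis
    by (intro commutantI)
      (simp_all add: assms[THEN commutant_outside] assms[THEN commutant_in] assms[THEN commutant_add]
        assms[THEN commutant_scale] assms[THEN commutant_commutes] subspace_fin_space
        subspace_add subspace_scale )
qed

lemma commutant_id: "(\<lambda>x. if x \<in> fin_space A then x else 0) \<in> commutant A"
  using subspace_fin_space
  by (intro commutantI) (simp_all add: subspace_add subspace_scale fin_part_apply_in_fin_space)

end

section \<open>The commutant and the minimal rank\<close>

text \<open>
From now on \<open>T\<close> has the least rank among the nonzero finite rank operators of \<open>A\<close>, and \<open>e\<close> is a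
nonzero vector in its range \<open>V\<close>. The vector \<open>e\<close> becomes the unit of an algebra structure on \<open>V\<close>.
\<close>

locale l_algebra_minimal = l_algebra A for A :: "('a::real_normed_vector \<Rightarrow>\<^sub>L 'a) set" +
  fixes T :: "'a \<Rightarrow>\<^sub>L 'a" and e :: 'a
  assumes T: "T \<in> fin_part A" "op_rank T = min_rank A"
    and e: "e \<in> range (blinfun_apply T)" "e \<noteq> 0"
begin

abbreviation "V \<equiv> range (blinfun_apply T)"

lemma V_fin_space: "v \<in> V \<Longrightarrow> v \<in> fin_space A"
  using fin_part_apply_in_fin_space[OF T(1)] by blast

lemma e_fin_space: "e \<in> fin_space A"
  by (rule V_fin_space[OF e(1)])

text \<open>
If \<open>U\<close> maps into \<open>V\<close> and does not vanish on \<open>V\<close>, then \<open>U T\<close> is nonzero and its range lies in \<open>V\<close>.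
Minimality forces that range to be all of \<open>V\<close>, so \<open>U\<close> maps \<open>V\<close> onto itself and is injective there.
\<close>

lemma minimal_rank_injective:
  assumes U: "U \<in> fin_part A" "range (blinfun_apply U) \<subseteq> V"
    and w: "w \<in> V" "blinfun_apply U w \<noteq> 0"
    and v: "v \<in> V" "blinfun_apply U v = 0"
  shows "v = 0"
proof (rule linear_surj_on_finite_dim_inj[OF linear_blinfun_apply, of V U])
  let ?UT = "U o\<^sub>L T"
  have UT: "?UT \<in> fin_part A"
    using U(1) T(1) by (intro compose_fin_part_left fin_part_in_A)
  have "blinfun_apply ?UT x \<noteq> 0" if "w = blinfun_apply T x" for x
    using w(2) that by simp
  then have "?UT \<noteq> 0"
    using w(1) by (metis imageE zero_blinfun.rep_eq)
  then have "min_rank A \<le> op_rank ?UT"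
    unfolding min_rank_def using UT by (intro Least_le) blast
  then have "range (blinfun_apply ?UT) = V"
    using U(2) T(2) unfolding op_rank_def
    by (intro subspace_eq_of_dim_le subspace_range_blinfun fin_part_finite_dim[OF T(1)]) auto
  then show "blinfun_apply U ` V = V"
    by (simp add: image_image)
qed (use v in \<open>auto intro: subspace_range_blinfun fin_part_finite_dim[OF T(1)]\<close>)

text \<open>
This is what makes the operators of the commutant constructed below well defined. If \<open>F w \<noteq> 0\<close>,
irreducibility provides \<open>G\<close> with \<open>T G F w \<noteq> 0\<close>; then \<open>T G F\<close> maps into \<open>V\<close> and is injective on
\<open>V\<close>, although it kills \<open>e\<close>.
\<close>

lemma fin_part_annihilates_range:
  assumes F: "F \<in> fin_part A" "blinfun_apply F e = 0" and w: "w \<in> V"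
  shows "blinfun_apply F w = 0"
proof (rule ccontr)
  assume Fw: "blinfun_apply F w \<noteq> 0"
  obtain G where G: "G \<in> fin_part A" "blinfun_apply T (blinfun_apply G (blinfun_apply F w)) \<noteq> 0"
  proof -
    obtain x where x: "x \<in> fin_space A" "blinfun_apply T x = e"
      using fin_part_apply_fin_space[OF T(1)] e(1) by (metis imageE)
    obtain G where "G \<in> fin_part A" "blinfun_apply G (blinfun_apply F w) = x"
      using fin_part_irreducible[OF Fw x(1)] .
    then show ?thesis
      using that x e(2) by simp
  qed
  let ?U = "T o\<^sub>L G o\<^sub>L F"
  have "?U \<in> fin_part A"
    using T(1) G(1) F(1) by (intro compose_fin_part_left compose_A fin_part_in_A)
  moreover have "range (blinfun_apply ?U) \<subseteq> V"
    by auto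
  ultimately have "e = 0"
    using w G(2) e(1) F(2) by (intro minimal_rank_injective[of ?U w e]) (simp_all add: blinfun.zero_right)
  then show False
    using e(2) by simp
qed

text \<open>
The operator sends \<open>G e\<close> to \<open>G w\<close> for all \<open>G\<close> in \<open>fin_part A\<close>; by irreducibility the vectors
\<open>G e\<close> exhaust \<open>fin_space A\<close>. That \<open>e\<close> itself goes to \<open>w\<close> needs an argument, as \<open>A\<close> may have no
unit: some \<open>F\<close> fixes \<open>e\<close>, and then \<open>G F\<close> and \<open>G\<close> agree at \<open>e\<close>, hence at \<open>w\<close>, for every \<open>G\<close>.
Therefore \<open>F w - w\<close> is killed by \<open>fin_part A\<close> and vanishes.
\<close>

lemma commutant_exists:
  assumes w: "w \<in> V"
  shows "\<exists>S\<in>commutant A. S e = w"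
proof -
  define S where "S y = (if y \<in> fin_space A then
    blinfun_apply (SOME G. G \<in> fin_part A \<and> blinfun_apply G e = y) w else 0)" for y
  have well_defined: "blinfun_apply F w = blinfun_apply G w"
    if "F \<in> fin_part A" "G \<in> fin_part A" "blinfun_apply F e = blinfun_apply G e" for F G
    using fin_part_annihilates_range[of "F - G" w] that w subspace_fin_part
    by (simp add: blinfun.diff_left subspace_diff)
  have S: "S (blinfun_apply G e) = blinfun_apply G w" if G: "G \<in> fin_part A" for G
  proof -
    let ?G = "SOME H. H \<in> fin_part A \<and> blinfun_apply H e = blinfun_apply G e"
    have "?G \<in> fin_part A \<and> blinfun_apply ?G e = blinfun_apply G e"
      using G by (intro someI[of "\<lambda>H. H \<in> fin_part A \<and> blinfun_apply H e = blinfun_apply G e"]) simp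
    then show ?thesis
      using well_defined[OF _ G] fin_part_apply_in_fin_space[OF G] by (simp add: S_def)
  qed
  have orbit: "\<exists>G\<in>fin_part A. y = blinfun_apply G e" if "y \<in> fin_space A" for y
    using fin_part_irreducible[OF e(2) that] by metis
  have "S \<in> commutant A"
  proof (rule commutantI)
    fix x assume "x \<notin> fin_space A"
    then show "S x = 0" by (simp add: S_def)
  next
    fix x assume "x \<in> fin_space A"
    then obtain G where "G \<in> fin_part A" "x = blinfun_apply G e" using orbit by blast
    then show "S x \<in> fin_space A"
      by (simp add: S fin_part_apply_in_fin_space)
  next
    fix x y assume "x \<in> fin_space A" "y \<in> fin_space A"
    then obtain G H where "G \<in> fin_part A" "x = blinfun_apply G e"
      "H \<in> fin_part A" "y = blinfun_apply H e" using orbit by metis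
    then show "S (x + y) = S x + S y"
      using S[of "G + H"] subspace_fin_part by (simp add: S subspace_add blinfun.add_left)
  next
    fix c x assume "x \<in> fin_space A"
    then obtain G where "G \<in> fin_part A" "x = blinfun_apply G e" using orbit by blast
    then show "S (c *\<^sub>R x) = c *\<^sub>R S x"
      using S[of "c *\<^sub>R G"] subspace_fin_part by (simp add: S subspace_scale blinfun.scaleR_left)
  next
    fix F x assume F: "F \<in> fin_part A" and "x \<in> fin_space A"
    then obtain G where G: "G \<in> fin_part A" "x = blinfun_apply G e" using orbit by blast
    have "F o\<^sub>L G \<in> fin_part A"
      using F G by (intro compose_fin_part_left fin_part_in_A)
    then show "S (blinfun_apply F x) = blinfun_apply F (S x)"
      using S[of "F o\<^sub>L G"] G by (simp add: S)
  qed
  moreover have "S e = w"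
  proof -
    obtain F where F: "F \<in> fin_part A" "blinfun_apply F e = e"
      using fin_part_irreducible[OF e(2) e_fin_space] .
    have "blinfun_apply G (blinfun_apply F w - w) = 0" if G: "G \<in> fin_part A" for G
    proof -
      have "G o\<^sub>L F \<in> fin_part A"
        using G F by (intro compose_fin_part_left fin_part_in_A)
      from well_defined[OF this G] show ?thesis
        using F by (simp add: blinfun.diff_right)
    qed
    then have "blinfun_apply F w - w = 0"
      by (rule fin_part_separates)
    then show ?thesis
      using S[OF F(1)] F(2) by simp
  qed
  ultimately show ?thesis by blast
qed

lemma commutant_maps_range:
  assumes "S \<in> commutant A" "v \<in> V"
  shows "S v \<in> V"
proof -
  obtain x where "x \<in> fin_space A" "v = blinfun_apply T x"
    using fin_part_apply_fin_space[OF T(1)] assms(2) by (metis imageE)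
  then show ?thesis
    using commutant_commutes[OF assms(1) T(1)] by simp
qed

lemma commutant_eqI_at_e:
  "S \<in> commutant A \<Longrightarrow> S' \<in> commutant A \<Longrightarrow> S e = S' e \<Longrightarrow> S = S'"
  by (rule commutant_eqI[OF _ _ e_fin_space e(2)])

lemma bij_betw_eval_commutant: "bij_betw (\<lambda>S. S e) (commutant A) V"
proof (rule bij_betw_imageI)
  show "inj_on (\<lambda>S. S e) (commutant A)"
    by (intro inj_onI commutant_eqI_at_e)
  show "(\<lambda>S. S e) ` commutant A = V"
  proof
    show "(\<lambda>S. S e) ` commutant A \<subseteq> V"
      using commutant_maps_range[OF _ e(1)] by (rule image_subsetI)
    show "V \<subseteq> (\<lambda>S. S e) ` commutant A"
    proof
      fix w assume "w \<in> V"
      then obtain S where "S \<in> commutant A" "S e = w"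
        using commutant_exists by blast
      then show "w \<in> (\<lambda>S. S e) ` commutant A"
        by blast
    qed
  qed
qed

text \<open>
Evaluation at \<open>e\<close> identifies the commutant with \<open>V\<close>, whose dimension is the minimal rank.
\<close>

lemma commutant_iso_imp_min_rank:
  fixes \<phi> :: "'b::real_algebra_1 \<Rightarrow> 'a \<Rightarrow> 'a"
  assumes "commutant_iso A \<phi>"
  shows "min_rank A = dim (UNIV :: 'b set)"
proof -
  let ?g = "\<lambda>b. \<phi> b e"
  have "bij_betw ((\<lambda>S. S e) \<circ> \<phi>) UNIV V"
    using assms unfolding commutant_iso_def by (intro bij_betw_trans[OF _ bij_betw_eval_commutant]) blast
  then have "bij_betw ?g UNIV V"
    by (simp add: comp_def)
  moreover have "linear ?g"
    using assms unfolding commutant_iso_def by (intro linearI) simp_all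
  ultimately have "dim V = dim (UNIV :: 'b set)"
    by (intro dim_linear_bij[of ?g]) (auto simp: bij_betw_def)
  then show ?thesis
    using T(2) by (simp add: op_rank_def)
qed

end

section \<open>The commutant as a division algebra\<close>

context l_algebra_minimal
begin

text \<open>
The inverse of evaluation at \<open>e\<close>. Applying \<open>commutant_op u\<close> to \<open>v\<close> carries the composition of
the commutant over to \<open>V\<close>, because \<open>commutant_op u \<circ> commutant_op v\<close> sends \<open>e\<close> to
\<open>commutant_op u v\<close>.
\<close>

definition commutant_op :: "'a \<Rightarrow> 'a \<Rightarrow> 'a" where
  "commutant_op v = (THE S. S \<in> commutant A \<and> S e = v)"

lemma commutant_op:
  assumes "v \<in> V"
  shows commutant_op_in: "commutant_op v \<in> commutant A"
    and commutant_op_e: "commutant_op v e = v"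
proof -
  obtain S where S: "S \<in> commutant A" "S e = v"
    using commutant_exists[OF assms] by blast
  then have "commutant_op v = S"
    unfolding commutant_op_def by (intro the_equality) (auto intro: commutant_eqI_at_e)
  then show "commutant_op v \<in> commutant A" "commutant_op v e = v"
    using S by simp_all
qed

lemma commutant_op_eqI: "S \<in> commutant A \<Longrightarrow> S e = v \<Longrightarrow> commutant_op v = S"
  using commutant_maps_range[OF _ e(1)]
  by (intro commutant_eqI_at_e) (auto simp: commutant_op_in commutant_op_e)

lemma commutant_op_add:
  assumes "u \<in> V" "v \<in> V"
  shows "commutant_op (u + v) = (\<lambda>x. commutant_op u x + commutant_op v x)"
  by (rule commutant_op_eqI) (simp_all add: commutant_plus commutant_op assms)

lemma commutant_op_scaleR:
  assumes "v \<in> V"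
  shows "commutant_op (c *\<^sub>R v) = (\<lambda>x. c *\<^sub>R commutant_op v x)"
  by (rule commutant_op_eqI) (simp_all add: commutant_scaleR commutant_op assms)

lemma commutant_op_mult:
  assumes "u \<in> V" "v \<in> V"
  shows "commutant_op (commutant_op u v) = commutant_op u \<circ> commutant_op v"
  by (rule commutant_op_eqI) (simp_all add: commutant_comp commutant_op assms)

lemma commutant_op_unit: "commutant_op e = (\<lambda>x. if x \<in> fin_space A then x else 0)"
  by (rule commutant_op_eqI) (simp_all add: commutant_id e_fin_space)

sublocale division_algebra_on V commutant_op e
proof
  show "subspace V"
    by (rule subspace_range_blinfun)
  show "finite_dim V"
    by (rule fin_part_finite_dim[OF T(1)])
  show "e \<in> V" "e \<noteq> 0"
    by (fact e)+
next
  fix x y assume "x \<in> V" "y \<in> V"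
  then show "commutant_op x y \<in> V"
    by (rule commutant_maps_range[OF commutant_op_in])
next
  fix x y z assume "x \<in> V" "y \<in> V" "z \<in> V"
  then show "commutant_op (x + y) z = commutant_op x z + commutant_op y z"
    and "commutant_op x (y + z) = commutant_op x y + commutant_op x z"
    and "commutant_op (commutant_op x y) z = commutant_op x (commutant_op y z)"
    by (simp_all only: commutant_op_add commutant_op_mult comp_apply
        commutant_add[OF commutant_op_in] V_fin_space)
next
  fix x y c assume "x \<in> V" "y \<in> V"
  then show "commutant_op (c *\<^sub>R x) y = c *\<^sub>R commutant_op x y"
    and "commutant_op x (c *\<^sub>R y) = c *\<^sub>R commutant_op x y"
    by (simp_all only: commutant_op_scaleR commutant_scale[OF commutant_op_in] V_fin_space)
next
  fix x assume "x \<in> V"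
  then show "commutant_op e x = x" "commutant_op x e = x"
    by (simp_all only: commutant_op_unit V_fin_space commutant_op_e if_True)
next
  fix x y assume x: "x \<in> V" and y: "y \<in> V" and zero: "commutant_op x y = 0"
  show "x = 0 \<or> y = 0"
  proof (rule disjCI)
    assume "y \<noteq> 0"
    have "(\<lambda>z. 0 *\<^sub>R commutant_op x z) \<in> commutant A"
      using commutant_op_in[OF x] by (intro commutant_scaleR)
    then have "commutant_op x = (\<lambda>z. 0 *\<^sub>R commutant_op x z)"
      using commutant_eqI[OF commutant_op_in[OF x] _ V_fin_space[OF y] \<open>y \<noteq> 0\<close>] zero by simp
    then have "commutant_op x e = 0"
      by (metis scaleR_zero_left)
    then show "x = 0"
      using commutant_op_e[OF x] by simp
  qed
qed

lemma algebra_iso_imp_commutant_iso: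
  fixes f :: "'b::real_algebra_1 \<Rightarrow> 'a"
  assumes "algebra_iso f"
  shows "commutant_iso A (\<lambda>a. commutant_op (f a))"
proof -
  have bij: "bij_betw f UNIV V" and lin: "linear f"
    and mult: "\<And>a b. f (a * b) = commutant_op (f a) (f b)" and one: "f 1 = e"
    using assms unfolding algebra_iso_def by auto
  have in_V: "f a \<in> V" for a
    using bij by (auto simp: bij_betw_def)
  have "bij_betw commutant_op V (commutant A)"
  proof (rule bij_betw_byWitness[where f' = "\<lambda>S. S e"])
    show "\<forall>v\<in>V. commutant_op v e = v" "commutant_op ` V \<subseteq> commutant A"
      using commutant_op by blast+
    show "\<forall>S\<in>commutant A. commutant_op (S e) = S"
      by (intro ballI commutant_op_eqI refl)
    show "(\<lambda>S. S e) ` commutant A \<subseteq> V"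
      by (intro image_subsetI commutant_maps_range[OF _ e(1)])
  qed
  then have "bij_betw (commutant_op \<circ> f) UNIV (commutant A)"
    by (rule bij_betw_trans[OF bij])
  then show ?thesis
    using in_V unfolding commutant_iso_def
    by (simp add: comp_def[of commutant_op f] linear_add[OF lin] linear_scale[OF lin] mult one
        commutant_op_add commutant_op_scaleR commutant_op_mult commutant_op_unit)
qed

lemma commutant_trichotomy: "real_type A \<or> complex_type A \<or> quaternion_type A"
  using frobenius unfolding real_type_def complex_type_def quaternion_type_def
  by (elim disjE exE) (blast intro: algebra_iso_imp_commutant_iso)+

lemma min_rank_of_type:
  shows "real_type A \<Longrightarrow> min_rank A = 1"
    and "complex_type A \<Longrightarrow> min_rank A = 2"
    and "quaternion_type A \<Longrightarrow> min_rank A = 4"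
  unfolding real_type_def complex_type_def quaternion_type_def
  by (auto dest!: commutant_iso_imp_min_rank simp: dim_quat)

end

theorem theorem2p15:
  fixes A :: "('a::banach \<Rightarrow>\<^sub>L 'a) set"
  assumes "\<not> finite_dim (UNIV :: 'a set)"
    and "L_algebra A"
  shows "(real_type A \<longleftrightarrow> min_rank A = 1) \<and>
    (complex_type A \<longleftrightarrow> min_rank A = 2) \<and>
    (quaternion_type A \<longleftrightarrow> min_rank A = 4)"
proof -
  interpret l_algebra A
    by unfold_locales (rule assms(2))
  obtain T\<^sub>0 where "T\<^sub>0 \<in> fin_part A" "T\<^sub>0 \<noteq> 0"
    by (rule fin_part_nonzero)
  then have "\<exists>n. \<exists>T\<in>fin_part A. T \<noteq> 0 \<and> op_rank T = n"
    by blast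
  then have "\<exists>T\<in>fin_part A. T \<noteq> 0 \<and> op_rank T = min_rank A"
    unfolding min_rank_def by (rule LeastI_ex)
  then obtain T where T: "T \<in> fin_part A" "T \<noteq> 0" "op_rank T = min_rank A"
    by blast
  then obtain x where x: "blinfun_apply T x \<noteq> 0"
    by (metis blinfun_eqI zero_blinfun.rep_eq)
  interpret l_algebra_minimal A T "blinfun_apply T x"
    by unfold_locales (use T x in auto)
  show ?thesis
    using commutant_trichotomy min_rank_of_type by auto
qed

end
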